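(* Every group is (isomorphic to) a quotient group of some group from the class $\mathcal{MZ}$.
   Context: Let $G$ be a group with identity $1$. Pick $x\notin G$ and let $G*\langle x\rangle$ be the free product of $G$ with the infinite cyclic group $\langle x\rangle\cong\mathbb{Z}$ generated by $x$. For $g\in G$ let $\mathrm{ev}_g:G*\langle x\rangle\to G$ be the unique homomorphism which sends $x$ to $g$ and is the identity on $G$. For $w\in G*\langle x\rangle$ put $E_w=\{g\in G:\mathrm{ev}_g(w)=1\}$. The Zariski topology $\mathfrak{Z}_G$ of $G$ is the coarsest topology on $G$ in which all sets $E_w$, $w\in G*\langle x\rangle$, are closed. The Markov topology $\mathfrak{M}_G$ of $G$ is the topology on $G$ whose closed sets are exactly the subsets of $G$ that are closed in every Hausdorff group topology on $G$. $\mathcal{MZ}$ denotes the class of all groups $G$ such that $\mathfrak{M}_G=\mathfrak{Z}_G$. *)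

theory Defs
  imports "HOL-Analysis.Analysis" "HOL-Algebra.Elementary_Groups"
begin

section \<open>The free product of two groups\<close>

definition fp_words :: "('a, 'm) monoid_scheme \<Rightarrow> ('b, 'n) monoid_scheme \<Rightarrow> ('a + 'b) list set"
  where "fp_words G H = lists (carrier G <+> carrier H)"

text \<open>
  The congruence on the monoid of words over the disjoint union of the two carriers that is
  generated by multiplying adjacent letters of the same group and by deleting identity letters.
\<close>

inductive_set fp_rel ::
    "('a, 'm) monoid_scheme \<Rightarrow> ('b, 'n) monoid_scheme \<Rightarrow> (('a + 'b) list \<times> ('a + 'b) list) set"
  for G :: "('a, 'm) monoid_scheme" and H :: "('b, 'n) monoid_scheme"
where
  fp_refl: "w \<in> fp_words G H \<Longrightarrow> (w, w) \<in> fp_rel G H"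
| fp_sym: "(v, w) \<in> fp_rel G H \<Longrightarrow> (w, v) \<in> fp_rel G H"
| fp_trans: "(u, v) \<in> fp_rel G H \<Longrightarrow> (v, w) \<in> fp_rel G H \<Longrightarrow> (u, w) \<in> fp_rel G H"
| fp_mult_left: "u \<in> fp_words G H \<Longrightarrow> v \<in> fp_words G H \<Longrightarrow> a \<in> carrier G \<Longrightarrow> b \<in> carrier G \<Longrightarrow>
    (u @ [Inl a, Inl b] @ v, u @ [Inl (a \<otimes>\<^bsub>G\<^esub> b)] @ v) \<in> fp_rel G H"
| fp_mult_right: "u \<in> fp_words G H \<Longrightarrow> v \<in> fp_words G H \<Longrightarrow> c \<in> carrier H \<Longrightarrow> d \<in> carrier H \<Longrightarrow>
    (u @ [Inr c, Inr d] @ v, u @ [Inr (c \<otimes>\<^bsub>H\<^esub> d)] @ v) \<in> fp_rel G H"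
| fp_one_left: "u \<in> fp_words G H \<Longrightarrow> v \<in> fp_words G H \<Longrightarrow>
    (u @ [Inl \<one>\<^bsub>G\<^esub>] @ v, u @ v) \<in> fp_rel G H"
| fp_one_right: "u \<in> fp_words G H \<Longrightarrow> v \<in> fp_words G H \<Longrightarrow>
    (u @ [Inr \<one>\<^bsub>H\<^esub>] @ v, u @ v) \<in> fp_rel G H"

definition fp_class ::
    "('a, 'm) monoid_scheme \<Rightarrow> ('b, 'n) monoid_scheme \<Rightarrow> ('a + 'b) list \<Rightarrow> ('a + 'b) list set"
  where "fp_class G H w = fp_rel G H `` {w}"

definition free_product ::
    "('a, 'm) monoid_scheme \<Rightarrow> ('b, 'n) monoid_scheme \<Rightarrow> ('a + 'b) list set monoid"
  where "free_product G H =
    \<lparr>carrier = fp_words G H // fp_rel G H,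
     monoid.mult = (\<lambda>X Y. \<Union>u\<in>X. \<Union>v\<in>Y. fp_class G H (u @ v)),
     one = fp_class G H []\<rparr>"

definition fp_inl :: "('a, 'm) monoid_scheme \<Rightarrow> ('b, 'n) monoid_scheme \<Rightarrow> 'a \<Rightarrow> ('a + 'b) list set"
  where "fp_inl G H a = fp_class G H [Inl a]"

definition fp_inr :: "('a, 'm) monoid_scheme \<Rightarrow> ('b, 'n) monoid_scheme \<Rightarrow> 'b \<Rightarrow> ('a + 'b) list set"
  where "fp_inr G H b = fp_class G H [Inr b]"

lemma fp_words_Nil [simp]: "[] \<in> fp_words G H"
  and fp_words_Cons [simp]: "l # w \<in> fp_words G H \<longleftrightarrow> l \<in> carrier G <+> carrier H \<and> w \<in> fp_words G H"
  and fp_words_append [simp]: "u @ v \<in> fp_words G H \<longleftrightarrow> u \<in> fp_words G H \<and> v \<in> fp_words G H"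
  by (auto simp: fp_words_def)

lemma Inl_in_Plus [simp]: "Inl a \<in> A <+> B \<longleftrightarrow> a \<in> A"
  and Inr_in_Plus [simp]: "Inr b \<in> A <+> B \<longleftrightarrow> b \<in> B"
  by auto

lemma fp_rel_words:
  assumes "group G" "group H" "(u, v) \<in> fp_rel G H"
  shows "u \<in> fp_words G H" "v \<in> fp_words G H"
proof -
  interpret G: group G by fact
  interpret H: group H by fact
  have "u \<in> fp_words G H \<and> v \<in> fp_words G H"
    using assms(3) by induction auto
  then show "u \<in> fp_words G H" "v \<in> fp_words G H" by auto
qed

lemma equiv_fp_rel:
  assumes "group G" "group H"
  shows "equiv (fp_words G H) (fp_rel G H)"
proof (rule equivI)
  show "fp_rel G H \<subseteq> fp_words G H \<times> fp_words G H"
    using fp_rel_words[OF assms] by auto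
  show "refl_on (fp_words G H) (fp_rel G H)"
    by (auto simp: refl_on_def intro: fp_refl)
  show "sym (fp_rel G H)" by (auto intro: symI fp_sym)
  show "trans (fp_rel G H)" by (auto intro: transI fp_trans)
qed

lemma fp_rel_context:
  assumes "(v, w) \<in> fp_rel G H" "u \<in> fp_words G H" "z \<in> fp_words G H"
  shows "(u @ v @ z, u @ w @ z) \<in> fp_rel G H"
  using assms(1)
proof induction
  case (fp_refl w)
  then show ?case using assms by (intro fp_rel.fp_refl) auto
next
  case (fp_mult_left s t a b)
  then show ?case using assms fp_rel.fp_mult_left[of "u @ s" G H "t @ z" a b] by simp
next
  case (fp_mult_right s t a b)
  then show ?case using assms fp_rel.fp_mult_right[of "u @ s" G H "t @ z" a b] by simp
next
  case (fp_one_left s t)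
  then show ?case using assms fp_rel.fp_one_left[of "u @ s" G H "t @ z"] by simp
next
  case (fp_one_right s t)
  then show ?case using assms fp_rel.fp_one_right[of "u @ s" G H "t @ z"] by simp
qed (blast intro: fp_rel.fp_sym fp_rel.fp_trans)+

lemma fp_rel_append:
  assumes "group G" "group H" "(u, u') \<in> fp_rel G H" "(v, v') \<in> fp_rel G H"
  shows "(u @ v, u' @ v') \<in> fp_rel G H"
  using fp_rel_context[OF assms(3), of "[]" v] fp_rel_context[OF assms(4), of u' "[]"]
    fp_rel_words[OF assms(1,2) assms(3)] fp_rel_words[OF assms(1,2) assms(4)]
  by (auto intro: fp_trans)

lemma fp_class_eq_iff:
  assumes "group G" "group H" "u \<in> fp_words G H" "v \<in> fp_words G H"
  shows "fp_class G H u = fp_class G H v \<longleftrightarrow> (u, v) \<in> fp_rel G H"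
  unfolding fp_class_def by (rule eq_equiv_class_iff[OF equiv_fp_rel[OF assms(1,2)] assms(3,4)])

lemma carrier_free_product: "carrier (free_product G H) = fp_class G H ` fp_words G H"
  by (auto simp: free_product_def quotient_def fp_class_def)

lemma one_free_product: "\<one>\<^bsub>free_product G H\<^esub> = fp_class G H []"
  by (simp add: free_product_def)

lemma mult_fp_class:
  assumes "group G" "group H" "u \<in> fp_words G H" "v \<in> fp_words G H"
  shows "fp_class G H u \<otimes>\<^bsub>free_product G H\<^esub> fp_class G H v = fp_class G H (u @ v)"
proof -
  have "congruent2 (fp_rel G H) (fp_rel G H) (\<lambda>u v. fp_class G H (u @ v))"
  proof (rule congruent2I')
    fix y1 z1 y2 z2 assume "(y1, z1) \<in> fp_rel G H" "(y2, z2) \<in> fp_rel G H"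
    then show "fp_class G H (y1 @ y2) = fp_class G H (z1 @ z2)"
      using fp_rel_words[OF assms(1,2)]
      by (subst fp_class_eq_iff[OF assms(1,2)]) (auto intro: fp_rel_append[OF assms(1,2)])
  qed
  from UN_equiv_class2[OF equiv_fp_rel[OF assms(1,2)] equiv_fp_rel[OF assms(1,2)] this assms(3,4)]
  show ?thesis by (simp add: free_product_def fp_class_def)
qed

lemma group_free_product:
  assumes "group G" "group H"
  shows "group (free_product G H)"
proof -
  interpret G: group G by fact
  interpret H: group H by fact
  note mult = mult_fp_class[OF assms]
  note class_eq = fp_class_eq_iff[OF assms]
  have inv_ex: "\<exists>v\<in>fp_words G H. (v @ w, []) \<in> fp_rel G H" if "w \<in> fp_words G H" for w
    using that
  proof (induction w)
    case Nil
    then show ?case by (intro bexI[of _ "[]"]) (auto intro: fp_refl)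
  next
    case (Cons l w)
    then obtain v where v: "v \<in> fp_words G H" "(v @ w, []) \<in> fp_rel G H" by auto
    have w: "w \<in> fp_words G H" using Cons by simp
    have "\<exists>m \<in> carrier G <+> carrier H. (v @ [m, l] @ w, v @ w) \<in> fp_rel G H"
    proof (cases l)
      case (Inl a)
      then have "a \<in> carrier G" using Cons by auto
      then show ?thesis
        using Inl fp_mult_left[OF v(1) w, of "inv\<^bsub>G\<^esub> a" a] fp_one_left[OF v(1) w]
        by (intro bexI[of _ "Inl (inv\<^bsub>G\<^esub> a)"]) (auto intro: fp_trans)
    next
      case (Inr a)
      then have "a \<in> carrier H" using Cons by auto
      then show ?thesis
        using Inr fp_mult_right[OF v(1) w, of "inv\<^bsub>H\<^esub> a" a] fp_one_right[OF v(1) w]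
        by (intro bexI[of _ "Inr (inv\<^bsub>H\<^esub> a)"]) (auto intro: fp_trans)
    qed
    then obtain m where "m \<in> carrier G <+> carrier H" "(v @ [m, l] @ w, v @ w) \<in> fp_rel G H" by auto
    then show ?case using v by (intro bexI[of _ "v @ [m]"]) (auto intro: fp_trans)
  qed
  show ?thesis
  proof (rule groupI)
    fix X assume "X \<in> carrier (free_product G H)"
    then obtain w where w: "X = fp_class G H w" "w \<in> fp_words G H"
      by (auto simp: carrier_free_product)
    then obtain v where "v \<in> fp_words G H" "(v @ w, []) \<in> fp_rel G H" using inv_ex by blast
    then show "\<exists>Y\<in>carrier (free_product G H). Y \<otimes>\<^bsub>free_product G H\<^esub> X = \<one>\<^bsub>free_product G H\<^esub>"
      using w by (intro bexI[of _ "fp_class G H v"])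
        (auto simp: carrier_free_product one_free_product mult class_eq)
  qed (auto simp: carrier_free_product one_free_product mult)
qed

lemma hom_fp_inl:
  assumes "group G" "group H"
  shows "fp_inl G H \<in> hom G (free_product G H)"
proof (rule homI)
  interpret G: group G by fact
  fix a b assume ab: "a \<in> carrier G" "b \<in> carrier G"
  then show "fp_inl G H a \<in> carrier (free_product G H)"
    by (auto simp: fp_inl_def carrier_free_product)
  show "fp_inl G H (a \<otimes>\<^bsub>G\<^esub> b) = fp_inl G H a \<otimes>\<^bsub>free_product G H\<^esub> fp_inl G H b"
    using ab fp_mult_left[of "[]" G H "[]" a b]
    by (simp add: fp_inl_def mult_fp_class[OF assms] fp_class_eq_iff[OF assms] fp_sym)
qed

lemma hom_fp_inr:
  assumes "group G" "group H"
  shows "fp_inr G H \<in> hom H (free_product G H)"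
proof (rule homI)
  interpret H: group H by fact
  fix a b assume ab: "a \<in> carrier H" "b \<in> carrier H"
  then show "fp_inr G H a \<in> carrier (free_product G H)"
    by (auto simp: fp_inr_def carrier_free_product)
  show "fp_inr G H (a \<otimes>\<^bsub>H\<^esub> b) = fp_inr G H a \<otimes>\<^bsub>free_product G H\<^esub> fp_inr G H b"
    using ab fp_mult_right[of "[]" G H "[]" a b]
    by (simp add: fp_inr_def mult_fp_class[OF assms] fp_class_eq_iff[OF assms] fp_sym)
qed

text \<open>
  The universal property. Homomorphisms are restricted to be \<open>extensional\<close> since otherwise they
  would only be unique up to their values outside the carrier.
\<close>

theorem free_product_universal:
  assumes "group G" "group H" "group K" "f \<in> hom G K" "g \<in> hom H K"
  shows "\<exists>!h. h \<in> hom (free_product G H) K \<and> h \<in> extensional (carrier (free_product G H)) \<and>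
    (\<forall>a\<in>carrier G. h (fp_inl G H a) = f a) \<and> (\<forall>b\<in>carrier H. h (fp_inr G H b) = g b)"
proof -
  interpret G: group G by fact
  interpret H: group H by fact
  interpret K: group K by fact
  interpret f: group_hom G K f by unfold_locales fact
  interpret g: group_hom H K g by unfold_locales fact
  let ?P = "free_product G H"
  note mult = mult_fp_class[OF assms(1,2)]
  define e where "e = (\<lambda>w. foldr (\<lambda>l z. case_sum f g l \<otimes>\<^bsub>K\<^esub> z) w \<one>\<^bsub>K\<^esub>)"
  have e_Nil [simp]: "e [] = \<one>\<^bsub>K\<^esub>" by (simp add: e_def)
  have e_Cons [simp]: "e (l # w) = case_sum f g l \<otimes>\<^bsub>K\<^esub> e w" for l w by (simp add: e_def)
  have letter: "case_sum f g l \<in> carrier K" if "l \<in> carrier G <+> carrier H" for l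
    using that by auto
  have e_closed [simp]: "e w \<in> carrier K" if "w \<in> fp_words G H" for w
    using that by (induction w) (auto simp: letter)
  have e_append: "e (u @ v) = e u \<otimes>\<^bsub>K\<^esub> e v" if "u \<in> fp_words G H" "v \<in> fp_words G H" for u v
    using that by (induction u) (auto simp: letter K.m_assoc)
  have e_rel: "e u = e v" if "(u, v) \<in> fp_rel G H" for u v
    using that by induction (auto simp: e_append K.m_assoc)
  define h where "h = restrict (\<lambda>X. e (SOME w. w \<in> X)) (carrier ?P)"
  have h_class: "h (fp_class G H w) = e w" if w: "w \<in> fp_words G H" for w
  proof -
    have "w \<in> fp_class G H w" using w by (auto simp: fp_class_def intro: fp_refl)
    then have "(SOME v. v \<in> fp_class G H w) \<in> fp_class G H w" by (rule someI)
    then have "(w, SOME v. v \<in> fp_class G H w) \<in> fp_rel G H" by (simp add: fp_class_def)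
    from e_rel[OF this] w show ?thesis by (simp add: h_def carrier_free_product)
  qed
  show ?thesis
  proof (rule ex1I[of _ h], intro conjI)
    show "h \<in> hom ?P K"
      by (rule homI) (auto simp: carrier_free_product h_class mult e_append)
    show "h \<in> extensional (carrier ?P)" by (simp add: h_def)
    show "\<forall>a\<in>carrier G. h (fp_inl G H a) = f a" "\<forall>b\<in>carrier H. h (fp_inr G H b) = g b"
      by (auto simp: fp_inl_def fp_inr_def h_class)
  next
    fix k assume "k \<in> hom ?P K \<and> k \<in> extensional (carrier ?P) \<and>
      (\<forall>a\<in>carrier G. k (fp_inl G H a) = f a) \<and> (\<forall>b\<in>carrier H. k (fp_inr G H b) = g b)"
    then have k: "k \<in> hom ?P K" "k \<in> extensional (carrier ?P)"
      "\<And>a. a \<in> carrier G \<Longrightarrow> k (fp_class G H [Inl a]) = f a"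
      "\<And>b. b \<in> carrier H \<Longrightarrow> k (fp_class G H [Inr b]) = g b"
      by (auto simp: fp_inl_def fp_inr_def)
    interpret k: group_hom ?P K k
      using group_free_product[OF assms(1,2)] k(1)
      by (simp add: group_hom_def group_hom_axioms_def K.is_group)
    have "k (fp_class G H w) = e w" if "w \<in> fp_words G H" for w
      using that
    proof (induction w)
      case Nil
      then show ?case using k.hom_one by (simp add: one_free_product)
    next
      case (Cons l w)
      then have "fp_class G H (l # w) = fp_class G H [l] \<otimes>\<^bsub>?P\<^esub> fp_class G H w"
        by (simp add: mult)
      moreover have "fp_class G H [l] \<in> carrier ?P" "fp_class G H w \<in> carrier ?P"
        using Cons by (auto simp: carrier_free_product)
      ultimately show ?case using Cons k(3,4) by auto
    qed
    then show "k = h"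
      using k(2) by (intro extensionalityI[of _ "carrier ?P"])
        (auto simp: h_def[symmetric] carrier_free_product h_class, auto simp: h_def carrier_free_product)
  qed
qed


section \<open>The Zariski topology\<close>

text \<open>
  In \<open>integer_group\<close> the infinite cyclic group is written additively, with generator \<open>1\<close>.
\<close>

definition adjoin_free :: "('a, 'm) monoid_scheme \<Rightarrow> ('a + int) list set monoid"
  where "adjoin_free G = free_product G integer_group"

definition free_gen :: "('a, 'm) monoid_scheme \<Rightarrow> ('a + int) list set"
  where "free_gen G = fp_inr G integer_group 1"

definition ev :: "('a, 'm) monoid_scheme \<Rightarrow> 'a \<Rightarrow> ('a + int) list set \<Rightarrow> 'a"
  where "ev G g = (THE h. h \<in> hom (adjoin_free G) G \<and> h \<in> extensional (carrier (adjoin_free G)) \<and>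
    (\<forall>a\<in>carrier G. h (fp_inl G integer_group a) = a) \<and> h (free_gen G) = g)"

definition zariski_set :: "('a, 'm) monoid_scheme \<Rightarrow> ('a + int) list set \<Rightarrow> 'a set"
  where "zariski_set G w = {g \<in> carrier G. ev G g w = \<one>\<^bsub>G\<^esub>}"

text \<open>
  The carrier is added to the subbase because \<open>topology_generated_by\<close> takes the union of the
  subbase as the underlying set, and for trivial \<open>G\<close> all complements of the sets \<open>zariski_set G w\<close>
  are empty.
\<close>

definition zariski_topology :: "('a, 'm) monoid_scheme \<Rightarrow> 'a topology"
  where "zariski_topology G = topology_generated_by
    (insert (carrier G) {carrier G - zariski_set G w | w. w \<in> carrier (adjoin_free G)})"

lemma ev_ex1:
  assumes "group G" "g \<in> carrier G"
  shows "\<exists>!h. h \<in> hom (adjoin_free G) G \<and> h \<in> extensional (carrier (adjoin_free G)) \<and>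
    (\<forall>a\<in>carrier G. h (fp_inl G integer_group a) = a) \<and> h (free_gen G) = g"
proof -
  interpret G: group G by fact
  let ?Z = integer_group
  have Z: "group ?Z" "carrier ?Z = UNIV" by (simp_all add: carrier_integer_group)
  have pow_hom: "(\<lambda>n::int. g [^]\<^bsub>G\<^esub> n) \<in> hom ?Z G"
    using assms by (intro homI) (auto simp: integer_group_def G.int_pow_mult)
  have id_hom: "(\<lambda>a. a) \<in> hom G G" by (rule homI) auto
  have int_hom_eq: "(\<forall>n. h (fp_inr G ?Z n) = g [^]\<^bsub>G\<^esub> n) \<longleftrightarrow> h (free_gen G) = g"
    if h: "h \<in> hom (adjoin_free G) G" for h
  proof
    assume "\<forall>n. h (fp_inr G ?Z n) = g [^]\<^bsub>G\<^esub> n"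
    then show "h (free_gen G) = g" using assms by (simp add: free_gen_def G.int_pow_1)
  next
    assume g: "h (free_gen G) = g"
    have "h \<circ> fp_inr G ?Z \<in> hom ?Z G"
      using h hom_fp_inr[OF assms(1) Z(1)] by (auto simp: adjoin_free_def intro: hom_compose)
    then interpret k: group_hom ?Z G "h \<circ> fp_inr G ?Z"
      using Z by (simp add: group_hom_def group_hom_axioms_def G.is_group)
    have "(h \<circ> fp_inr G ?Z) (1 [^]\<^bsub>?Z\<^esub> n) = ((h \<circ> fp_inr G ?Z) 1) [^]\<^bsub>G\<^esub> n" for n :: int
      using k.hom_int_pow[of 1 n] Z by simp
    then have "h (fp_inr G ?Z n) = h (free_gen G) [^]\<^bsub>G\<^esub> n" for n
      unfolding free_gen_def o_def group_int_pow_integer_group mult_1_right .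
    then show "\<forall>n. h (fp_inr G ?Z n) = g [^]\<^bsub>G\<^esub> n" by (simp only: g) simp
  qed
  have "(h \<in> hom (adjoin_free G) G \<and> h \<in> extensional (carrier (adjoin_free G)) \<and>
      (\<forall>a\<in>carrier G. h (fp_inl G ?Z a) = a) \<and> (\<forall>n\<in>carrier ?Z. h (fp_inr G ?Z n) = g [^]\<^bsub>G\<^esub> n)) \<longleftrightarrow>
    (h \<in> hom (adjoin_free G) G \<and> h \<in> extensional (carrier (adjoin_free G)) \<and>
      (\<forall>a\<in>carrier G. h (fp_inl G ?Z a) = a) \<and> h (free_gen G) = g)" for h
    using int_hom_eq[of h] unfolding Z(2) by blast
  then show ?thesis
    using free_product_universal[OF assms(1) Z(1) assms(1) id_hom pow_hom]
    unfolding adjoin_free_def[symmetric] by (simp only:)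
qed

lemma ev_properties:
  assumes "group G" "g \<in> carrier G"
  shows "ev G g \<in> hom (adjoin_free G) G"
    and "a \<in> carrier G \<Longrightarrow> ev G g (fp_inl G integer_group a) = a"
    and "ev G g (free_gen G) = g"
  using theI'[OF ev_ex1[OF assms]] unfolding ev_def[symmetric] by auto

lemma topspace_zariski_topology [simp]: "topspace (zariski_topology G) = carrier G"
  by (auto simp: zariski_topology_def)

lemma closedin_zariski_set:
  "w \<in> carrier (adjoin_free G) \<Longrightarrow> closedin (zariski_topology G) (zariski_set G w)"
  unfolding closedin_def topspace_zariski_topology
  by (auto simp: zariski_topology_def zariski_set_def intro!: topology_generated_by_Basis)

lemma zariski_topology_coarsest:
  assumes "topspace T = carrier G"
    and "\<And>w. w \<in> carrier (adjoin_free G) \<Longrightarrow> closedin T (zariski_set G w)"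
    and "openin (zariski_topology G) U"
  shows "openin T U"
proof -
  have "generate_topology_on
      (insert (carrier G) {carrier G - zariski_set G w | w. w \<in> carrier (adjoin_free G)}) U"
    using assms(3) by (simp add: zariski_topology_def openin_topology_generated_by_iff)
  then show ?thesis
  proof induction
    case (Basis s)
    then show ?case
      using assms(1,2) openin_topspace[of T] by (auto simp: closedin_def)
  qed (auto intro: openin_Union)
qed


section \<open>The Markov topology\<close>

definition hausdorff_group_topology :: "('a, 'm) monoid_scheme \<Rightarrow> 'a topology \<Rightarrow> bool"
  where "hausdorff_group_topology G T \<longleftrightarrow>
    topspace T = carrier G \<and> Hausdorff_space T \<and>
    continuous_map (prod_topology T T) T (\<lambda>(x, y). x \<otimes>\<^bsub>G\<^esub> y) \<and>
    continuous_map T T (\<lambda>x. inv\<^bsub>G\<^esub> x)"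

definition markov_topology :: "('a, 'm) monoid_scheme \<Rightarrow> 'a topology"
  where "markov_topology G = topology (\<lambda>U. U \<subseteq> carrier G \<and>
    (\<forall>T. hausdorff_group_topology G T \<longrightarrow> closedin T (carrier G - U)))"

lemma openin_markov_topology:
  "openin (markov_topology G) U \<longleftrightarrow>
    U \<subseteq> carrier G \<and> (\<forall>T. hausdorff_group_topology G T \<longrightarrow> closedin T (carrier G - U))"
proof -
  let ?L = "\<lambda>U. U \<subseteq> carrier G \<and> (\<forall>T. hausdorff_group_topology G T \<longrightarrow> closedin T (carrier G - U))"
  have L: "?L U \<longleftrightarrow> U \<subseteq> carrier G \<and> (\<forall>T. hausdorff_group_topology G T \<longrightarrow> openin T U)" for U
    by (auto simp: hausdorff_group_topology_def openin_closedin_eq)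
  have "istopology ?L"
    unfolding L istopology_def by (auto intro: openin_Union)
  then show ?thesis by (simp add: markov_topology_def topology_inverse')
qed

lemma topspace_markov_topology [simp]: "topspace (markov_topology G) = carrier G"
proof -
  have "openin (markov_topology G) (carrier G)" by (simp add: openin_markov_topology)
  then show ?thesis
    using openin_markov_topology[of G] by (metis openin_subset openin_topspace subset_antisym)
qed

lemma closedin_markov_topology:
  "closedin (markov_topology G) C \<longleftrightarrow>
    C \<subseteq> carrier G \<and> (\<forall>T. hausdorff_group_topology G T \<longrightarrow> closedin T C)"
  by (auto simp: closedin_def[of "markov_topology G"] openin_markov_topology double_diff)

definition MZ :: "('a, 'm) monoid_scheme \<Rightarrow> bool"
  where "MZ G \<longleftrightarrow> group G \<and> markov_topology G = zariski_topology G"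

end

theory Submission
  imports Defs
begin

text \<open>
  The witness is a permutation group. For a set \<open>P\<close> of permutations of an infinite set that
  is a group and contains all transpositions, three topologies are compared: the Zariski
  topology, the Markov topology and the topology of pointwise convergence.

  A word with one variable defines a continuous function for every group topology, so the
  Zariski topology is always coarser than the Markov topology
  (\<open>openin_zariski_imp_markov\<close>). The topology of pointwise convergence is itself a Hausdorff group
  topology, so the Markov topology is coarser than it. The circle is closed by
  \<open>openin_zariski_point_image\<close>: the condition \<open>h x = y\<close> is Zariski open. This holds because the
  conjugate by \<open>h\<close> of a transposition \<open>(x c)\<close> is the transposition \<open>(h x, h c)\<close>, and a
  transposition fails to commute with a 3-cycle if and only if their supports meet. A failure to
  commute is the complement of a set \<open>E\<^sub>w\<close>, and finitely many such conditions, for several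
  points \<open>c\<close> and two 3-cycles that share the point \<open>y\<close> only, pin down \<open>h x = y\<close>.

  To realise \<open>G\<close> as a quotient, let it act on \<open>'a \<times> nat\<close> by left translation in each of the
  countably many copies of the carrier. Distinct elements of \<open>G\<close> then act differently at
  infinitely many points. Hence a permutation that agrees with the action of an element of \<open>G\<close>
  outside a finite set determines this element. These permutations form a group that contains
  all transpositions, and the element they determine is a surjective homomorphism onto \<open>G\<close>.
\<close>

section \<open>Zariski closed sets are closed in every Hausdorff group topology\<close>

lemma hausdorff_group_topology_mult:
  assumes T: "hausdorff_group_topology G T"
    and "continuous_map X T f" "continuous_map X T g"
  shows "continuous_map X T (\<lambda>z. f z \<otimes>\<^bsub>G\<^esub> g z)"
proof -
  have "continuous_map X (prod_topology T T) (\<lambda>z. (f z, g z))"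
    using assms(2,3) by (simp add: continuous_map_pairedI)
  from continuous_map_compose[OF this, of T "\<lambda>(x, y). x \<otimes>\<^bsub>G\<^esub> y"] T
  show ?thesis by (simp add: hausdorff_group_topology_def o_def)
qed

lemma hausdorff_group_topology_int_pow:
  assumes G: "group G" and T: "hausdorff_group_topology G T"
  shows "continuous_map T T (\<lambda>g. g [^]\<^bsub>G\<^esub> (n::int))"
proof -
  interpret G: group G by fact
  have top: "topspace T = carrier G" using T by (simp add: hausdorff_group_topology_def)
  have nat: "continuous_map T T (\<lambda>g. g [^]\<^bsub>G\<^esub> (k::nat))" for k
    by (induction k) (use top in \<open>auto intro: hausdorff_group_topology_mult[OF T]\<close>)
  have inv: "continuous_map T T (\<lambda>g. inv\<^bsub>G\<^esub> (g [^]\<^bsub>G\<^esub> (k::nat)))" for k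
    using continuous_map_compose[OF nat, of T "\<lambda>g. inv\<^bsub>G\<^esub> g" k] T
    by (simp add: hausdorff_group_topology_def o_def)
  show ?thesis
  proof (cases "n < 0")
    case True
    show ?thesis unfolding int_pow_def2 if_P[OF True] by (rule inv)
  next
    case False
    show ?thesis unfolding int_pow_def2 if_not_P[OF False] by (rule nat)
  qed
qed

lemma ev_int_power:
  assumes G: "group G" and g: "g \<in> carrier G"
  shows "ev G g (fp_inr G integer_group n) = g [^]\<^bsub>G\<^esub> n"
proof -
  interpret G: group G by fact
  have "ev G g \<circ> fp_inr G integer_group \<in> hom integer_group G"
    using ev_properties(1)[OF assms] hom_fp_inr[OF G group_integer_group]
    by (auto simp: adjoin_free_def intro: hom_compose)
  then interpret k: group_hom integer_group G "ev G g \<circ> fp_inr G integer_group"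
    by (simp add: group_hom_def group_hom_axioms_def G.is_group)
  have "(ev G g \<circ> fp_inr G integer_group) (1 [^]\<^bsub>integer_group\<^esub> n)
      = (ev G g (free_gen G)) [^]\<^bsub>G\<^esub> n"
    using k.hom_int_pow[of 1 n] by (simp add: free_gen_def carrier_integer_group)
  then show ?thesis
    unfolding ev_properties(3)[OF assms] group_int_pow_integer_group by simp
qed

text \<open>Induction on a word that represents \<open>w\<close>: each letter contributes a constant or a power.\<close>

lemma continuous_map_ev:
  assumes G: "group G" and T: "hausdorff_group_topology G T" and w: "w \<in> carrier (adjoin_free G)"
  shows "continuous_map T T (\<lambda>g. ev G g w)"
proof -
  interpret G: group G by fact
  let ?Z = integer_group
  have top: "topspace T = carrier G" using T by (simp add: hausdorff_group_topology_def)
  have "continuous_map T T (\<lambda>g. ev G g (fp_class G ?Z v))" if "v \<in> fp_words G ?Z" for v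
    using that
  proof (induction v)
    case Nil
    have ev_Nil: "ev G g (fp_class G ?Z []) = \<one>\<^bsub>G\<^esub>" if "g \<in> carrier G" for g
      using hom_one[OF ev_properties(1)[OF G that, unfolded adjoin_free_def]
          group_free_product[OF G group_integer_group] G]
      by (simp add: one_free_product)
    show ?case
      by (rule continuous_map_eq[where f = "\<lambda>_. \<one>\<^bsub>G\<^esub>"]) (auto simp: top ev_Nil)
  next
    case (Cons l v)
    then have v: "v \<in> fp_words G ?Z" and l: "[l] \<in> fp_words G ?Z" by auto
    have split: "ev G g (fp_class G ?Z (l # v)) = ev G g (fp_class G ?Z [l]) \<otimes>\<^bsub>G\<^esub> ev G g (fp_class G ?Z v)"
      if "g \<in> carrier G" for g
      using hom_mult[OF ev_properties(1)[OF G that], of "fp_class G ?Z [l]" "fp_class G ?Z v"]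
        mult_fp_class[OF G group_integer_group l v] l v
      by (simp add: adjoin_free_def carrier_free_product)
    have "continuous_map T T (\<lambda>g. ev G g (fp_class G ?Z [l]))"
    proof (cases l)
      case (Inl a)
      then have a: "a \<in> carrier G" using l by auto
      show ?thesis
        by (rule continuous_map_eq[where f = "\<lambda>_. a"])
          (use a ev_properties(2)[OF G] in \<open>auto simp: top Inl fp_inl_def\<close>)
    next
      case (Inr n)
      show ?thesis
        by (rule continuous_map_eq[OF hausdorff_group_topology_int_pow[OF G T, of n]])
          (use ev_int_power[OF G] in \<open>auto simp: top Inr fp_inr_def\<close>)
    qed
    from hausdorff_group_topology_mult[OF T this Cons.IH[OF v]] show ?case
      by (rule continuous_map_eq) (auto simp: top split)
  qed
  then show ?thesis using w by (auto simp: adjoin_free_def carrier_free_product)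
qed

lemma openin_zariski_imp_markov:
  assumes G: "group G" and U: "openin (zariski_topology G) U"
  shows "openin (markov_topology G) U"
proof (rule zariski_topology_coarsest[OF _ _ U])
  interpret G: group G by fact
  fix w assume w: "w \<in> carrier (adjoin_free G)"
  show "closedin (markov_topology G) (zariski_set G w)"
    unfolding closedin_markov_topology
  proof (intro conjI allI impI)
    show "zariski_set G w \<subseteq> carrier G" by (auto simp: zariski_set_def)
    fix T assume T: "hausdorff_group_topology G T"
    then have top: "topspace T = carrier G" and "closedin T {\<one>\<^bsub>G\<^esub>}"
      by (auto simp: hausdorff_group_topology_def intro: closedin_Hausdorff_singleton)
    then have "closedin T {g \<in> topspace T. ev G g w \<in> {\<one>\<^bsub>G\<^esub>}}"
      by (intro closedin_continuous_map_preimage[OF continuous_map_ev[OF G T w]])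
    then show "closedin T (zariski_set G w)"
      by (simp add: zariski_set_def top)
  qed
qed simp

text \<open>
  The source of all the Zariski open sets used below: the commutator of \<open>x t x\<inverse>\<close> and \<open>s\<close>, read as
  a word in the variable \<open>x\<close>.
\<close>

lemma openin_zariski_conjugate_not_commuting:
  assumes G: "group G" and t: "t \<in> carrier G" and s: "s \<in> carrier G"
  shows "openin (zariski_topology G) {h \<in> carrier G.
    (h \<otimes>\<^bsub>G\<^esub> t \<otimes>\<^bsub>G\<^esub> inv\<^bsub>G\<^esub> h) \<otimes>\<^bsub>G\<^esub> s \<noteq> s \<otimes>\<^bsub>G\<^esub> (h \<otimes>\<^bsub>G\<^esub> t \<otimes>\<^bsub>G\<^esub> inv\<^bsub>G\<^esub> h)}"
proof -
  interpret G: group G by fact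
  let ?F = "adjoin_free G"
  interpret F: group ?F
    unfolding adjoin_free_def by (rule group_free_product[OF G group_integer_group])
  define X S Y where "X = free_gen G" and "S = fp_inl G integer_group s"
    and "Y = X \<otimes>\<^bsub>?F\<^esub> fp_inl G integer_group t \<otimes>\<^bsub>?F\<^esub> inv\<^bsub>?F\<^esub> X"
  have inl: "fp_inl G integer_group a \<in> carrier ?F" if "a \<in> carrier G" for a
    using hom_in_carrier[OF hom_fp_inl[OF G group_integer_group] that] by (simp add: adjoin_free_def)
  have X: "X \<in> carrier ?F"
    using hom_in_carrier[OF hom_fp_inr[OF G group_integer_group], of 1]
    by (simp add: X_def free_gen_def adjoin_free_def carrier_integer_group)
  have S: "S \<in> carrier ?F" and Y: "Y \<in> carrier ?F"
    using inl s t X by (auto simp: S_def Y_def)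
  define w where "w = Y \<otimes>\<^bsub>?F\<^esub> S \<otimes>\<^bsub>?F\<^esub> inv\<^bsub>?F\<^esub> (S \<otimes>\<^bsub>?F\<^esub> Y)"
  have w: "w \<in> carrier ?F" using S Y by (simp add: w_def)
  have ev_w: "ev G h w = \<one>\<^bsub>G\<^esub> \<longleftrightarrow>
      (h \<otimes>\<^bsub>G\<^esub> t \<otimes>\<^bsub>G\<^esub> inv\<^bsub>G\<^esub> h) \<otimes>\<^bsub>G\<^esub> s = s \<otimes>\<^bsub>G\<^esub> (h \<otimes>\<^bsub>G\<^esub> t \<otimes>\<^bsub>G\<^esub> inv\<^bsub>G\<^esub> h)"
    if h: "h \<in> carrier G" for h
  proof -
    interpret e: group_hom ?F G "ev G h"
      using ev_properties(1)[OF G h]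
      by (simp add: group_hom_def group_hom_axioms_def F.is_group G.is_group)
    have eX: "ev G h X = h" and eS: "ev G h S = s"
      using ev_properties[OF G h] s by (auto simp: X_def S_def)
    have eY: "ev G h Y = h \<otimes>\<^bsub>G\<^esub> t \<otimes>\<^bsub>G\<^esub> inv\<^bsub>G\<^esub> h"
      using ev_properties(2)[OF G h t] inl[OF t] X by (simp add: Y_def eX)
    let ?y = "h \<otimes>\<^bsub>G\<^esub> t \<otimes>\<^bsub>G\<^esub> inv\<^bsub>G\<^esub> h"
    have y: "?y \<in> carrier G" using h t by simp
    have "ev G h w = (?y \<otimes>\<^bsub>G\<^esub> s) \<otimes>\<^bsub>G\<^esub> inv\<^bsub>G\<^esub> (s \<otimes>\<^bsub>G\<^esub> ?y)"
      unfolding w_def using S Y by (simp only: e.hom_mult e.hom_inv F.m_closed F.inv_closed eS eY)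
    moreover have "(p \<otimes>\<^bsub>G\<^esub> inv\<^bsub>G\<^esub> q = \<one>\<^bsub>G\<^esub>) = (p = q)" if "p \<in> carrier G" "q \<in> carrier G" for p q
      using that G.inv_equality[of p "inv\<^bsub>G\<^esub> q"] by auto
    ultimately show ?thesis using y s by simp
  qed
  have "{h \<in> carrier G. (h \<otimes>\<^bsub>G\<^esub> t \<otimes>\<^bsub>G\<^esub> inv\<^bsub>G\<^esub> h) \<otimes>\<^bsub>G\<^esub> s \<noteq> s \<otimes>\<^bsub>G\<^esub> (h \<otimes>\<^bsub>G\<^esub> t \<otimes>\<^bsub>G\<^esub> inv\<^bsub>G\<^esub> h)}
      = carrier G - zariski_set G w"
    using ev_w by (auto simp: zariski_set_def)
  then show ?thesis
    using closedin_zariski_set[OF w] by (simp add: closedin_def)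
qed

section \<open>Permutation groups and the topology of pointwise convergence\<close>

definition perm_group :: "('x \<Rightarrow> 'x) set \<Rightarrow> ('x \<Rightarrow> 'x) monoid"
  where "perm_group P = \<lparr>carrier = P, monoid.mult = (\<circ>), one = id\<rparr>"

lemma perm_group_simps [simp]:
  "carrier (perm_group P) = P" "f \<otimes>\<^bsub>perm_group P\<^esub> g = f \<circ> g" "\<one>\<^bsub>perm_group P\<^esub> = id"
  by (simp_all add: perm_group_def)

definition pointwise_topology :: "('x \<Rightarrow> 'x) set \<Rightarrow> ('x \<Rightarrow> 'x) topology"
  where "pointwise_topology P = topology_generated_by {{f \<in> P. f x = y} |x y. True}"

lemma topspace_pointwise_topology [simp]: "topspace (pointwise_topology P) = P"
  by (auto simp: pointwise_topology_def)

lemma openin_pointwise_basic: "openin (pointwise_topology P) {f \<in> P. f x = y}"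
  unfolding pointwise_topology_def by (rule topology_generated_by_Basis) auto

lemma continuous_map_pointwise:
  assumes "\<And>z. z \<in> topspace X \<Longrightarrow> F z \<in> P"
    and "\<And>x y. openin X {z \<in> topspace X. F z x = y}"
  shows "continuous_map X (pointwise_topology P) F"
  unfolding pointwise_topology_def
proof (rule continuous_on_generated_topo)
  show "F ` topspace X \<subseteq> \<Union> {{f \<in> P. f x = y} |x y. True}"
    using assms(1) by auto
  fix U assume "U \<in> {{f \<in> P. f x = y} |x y. True}"
  then obtain x y where "U = {f \<in> P. f x = y}" by auto
  then have "F -` U \<inter> topspace X = {z \<in> topspace X. F z x = y}"
    using assms(1) by auto
  then show "openin X (F -` U \<inter> topspace X)" using assms(2) by simp
qed

locale permutation_group =
  fixes P :: "('x \<Rightarrow> 'x) set"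
  assumes bij: "f \<in> P \<Longrightarrow> bij f"
    and id_mem: "id \<in> P"
    and comp_mem: "f \<in> P \<Longrightarrow> g \<in> P \<Longrightarrow> f \<circ> g \<in> P"
    and inv_mem: "f \<in> P \<Longrightarrow> inv_into UNIV f \<in> P"
begin

lemma group_perm_group: "group (perm_group P)"
proof (rule groupI)
  fix f assume "f \<in> carrier (perm_group P)"
  then show "\<exists>g\<in>carrier (perm_group P). g \<otimes>\<^bsub>perm_group P\<^esub> f = \<one>\<^bsub>perm_group P\<^esub>"
    using inv_mem[of f] bij[of f] by (intro bexI[of _ "inv_into UNIV f"]) (auto simp: bij_is_inj)
qed (auto simp: id_mem comp_mem o_assoc)

lemma m_inv_perm_group: "f \<in> P \<Longrightarrow> inv\<^bsub>perm_group P\<^esub> f = inv_into UNIV f"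
  using group.inv_equality[OF group_perm_group, of "inv_into UNIV f" f] inv_mem[of f] bij[of f]
  by (auto simp: bij_is_inj)

lemma hausdorff_group_topology_pointwise:
  "hausdorff_group_topology (perm_group P) (pointwise_topology P)"
  unfolding hausdorff_group_topology_def
proof (intro conjI)
  let ?T = "pointwise_topology P"
  show "topspace ?T = carrier (perm_group P)" by simp
  show "Hausdorff_space ?T"
    unfolding Hausdorff_space_def
  proof (intro allI impI, elim conjE)
    fix f g assume fg: "f \<in> topspace ?T" "g \<in> topspace ?T" "f \<noteq> g"
    then obtain x where "f x \<noteq> g x" by auto
    with fg show "\<exists>U V. openin ?T U \<and> openin ?T V \<and> f \<in> U \<and> g \<in> V \<and> disjnt U V"
      by (intro exI[of _ "{h \<in> P. h x = f x}"] exI[of _ "{h \<in> P. h x = g x}"])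
        (auto simp: openin_pointwise_basic disjnt_def)
  qed
  show "continuous_map (prod_topology ?T ?T) ?T (\<lambda>(f, g). f \<otimes>\<^bsub>perm_group P\<^esub> g)"
  proof (rule continuous_map_pointwise)
    fix x y
    have "{z \<in> topspace (prod_topology ?T ?T). (case z of (f, g) \<Rightarrow> f \<otimes>\<^bsub>perm_group P\<^esub> g) x = y}
        = (\<Union>c. {f \<in> P. f c = y} \<times> {g \<in> P. g x = c})"
      by auto
    moreover have "openin (prod_topology ?T ?T) \<dots>"
      by (intro openin_Union) (auto simp: openin_prod_Times_iff openin_pointwise_basic)
    ultimately show "openin (prod_topology ?T ?T) {z \<in> topspace (prod_topology ?T ?T).
        (case z of (f, g) \<Rightarrow> f \<otimes>\<^bsub>perm_group P\<^esub> g) x = y}" by simp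
  qed (auto simp: comp_mem)
  show "continuous_map ?T ?T (\<lambda>f. inv\<^bsub>perm_group P\<^esub> f)"
  proof (rule continuous_map_pointwise)
    fix x y
    have "{f \<in> topspace ?T. (inv\<^bsub>perm_group P\<^esub> f) x = y} = {f \<in> P. f y = x}"
      using bij by (auto simp: m_inv_perm_group bij_is_surj surj_f_inv_f bij_is_inj)
    then show "openin ?T {f \<in> topspace ?T. (inv\<^bsub>perm_group P\<^esub> f) x = y}"
      by (simp add: openin_pointwise_basic)
  qed (auto simp: m_inv_perm_group inv_mem)
qed

end

section \<open>Permutation groups containing all transpositions\<close>

text \<open>A name that cannot be confused with the transpose of a matrix.\<close>

abbreviation transposition :: "'x \<Rightarrow> 'x \<Rightarrow> 'x \<Rightarrow> 'x"
  where "transposition \<equiv> Transposition.transpose"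

text \<open>The two sides differ at \<open>b\<close>, which the 3-cycle sends to \<open>d\<close>.\<close>

lemma transposition_not_commuting_3_cycle:
  assumes "distinct [b, d, e]" "b \<noteq> q"
  shows "transposition b q \<circ> (transposition b d \<circ> transposition d e)
    \<noteq> (transposition b d \<circ> transposition d e) \<circ> transposition b q"
proof
  assume "transposition b q \<circ> (transposition b d \<circ> transposition d e)
    = (transposition b d \<circ> transposition d e) \<circ> transposition b q"
  from fun_cong[OF this, of b] show False
    using assms by (auto simp: Transposition.transpose_def split: if_splits)
qed

lemma transposition_commuting_disjoint_3_cycle:
  assumes "p \<notin> {b, d, e}" "q \<notin> {b, d, e}"
  shows "transposition p q \<circ> (transposition b d \<circ> transposition d e)
    = (transposition b d \<circ> transposition d e) \<circ> transposition p q"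
  using assms by (auto simp: Transposition.transpose_def fun_eq_iff)

locale transposition_group = permutation_group P for P :: "('x \<Rightarrow> 'x) set" +
  assumes transposition_mem: "transposition a b \<in> P"
    and infinite_points: "infinite (UNIV :: 'x set)"
begin

text \<open>
  A conjugate \<open>(h x, h c)\<close> that does not commute with the 3-cycle only shows that \<open>h x\<close> or \<open>h c\<close>
  lies in its support \<open>{b, d, e}\<close>. The intersection of these conditions over four points \<open>c\<close>
  excludes the second alternative: the injective map \<open>h\<close> cannot send four points into a
  three-element set.
\<close>

lemma openin_zariski_near_point_image:
  assumes "distinct [b, d, e]"
  obtains U where "openin (zariski_topology (perm_group P)) U"
    "{h \<in> P. h x = b} \<subseteq> U" "U \<subseteq> {h \<in> P. h x \<in> {b, d, e}}"
proof -
  let ?s = "transposition b d \<circ> transposition d e"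
  define V where "V c = {h \<in> P. transposition (h x) (h c) \<circ> ?s \<noteq> ?s \<circ> transposition (h x) (h c)}" for c
  have conj: "h \<circ> transposition x c \<circ> inv_into UNIV h = transposition (h x) (h c)" if "h \<in> P" for h c
  proof -
    have "transposition (h x) (h c) \<circ> h = h \<circ> transposition x c"
      using transpose_comp_eq[OF bij[OF that], of "h x" "h c"] bij[OF that]
      by (simp add: bij_is_inj)
    then have "h \<circ> transposition x c \<circ> inv_into UNIV h
        = transposition (h x) (h c) \<circ> (h \<circ> inv_into UNIV h)"
      by (simp add: o_assoc)
    moreover have "h \<circ> inv_into UNIV h = id"
      using bij[OF that] by (metis bij_is_surj surj_iff)
    ultimately show ?thesis by simp
  qed
  have V: "openin (zariski_topology (perm_group P)) (V c)" for c
  proof -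
    have "V c = {h \<in> carrier (perm_group P).
      (h \<otimes>\<^bsub>perm_group P\<^esub> transposition x c \<otimes>\<^bsub>perm_group P\<^esub> inv\<^bsub>perm_group P\<^esub> h) \<otimes>\<^bsub>perm_group P\<^esub> ?s
      \<noteq> ?s \<otimes>\<^bsub>perm_group P\<^esub> (h \<otimes>\<^bsub>perm_group P\<^esub> transposition x c \<otimes>\<^bsub>perm_group P\<^esub> inv\<^bsub>perm_group P\<^esub> h)}"
      by (simp add: V_def m_inv_perm_group conj cong: conj_cong)
    then show ?thesis
      using openin_zariski_conjugate_not_commuting[OF group_perm_group, of "transposition x c" ?s]
      by (simp add: transposition_mem comp_mem)
  qed
  have "infinite (UNIV - {x})" using infinite_points by simp
  then obtain C where C: "finite C" "card C = 4" "C \<subseteq> UNIV - {x}"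
    using infinite_arbitrarily_large by metis
  show thesis
  proof
    show "openin (zariski_topology (perm_group P)) (\<Inter>c\<in>C. V c)"
      using C V by (intro openin_Inter) auto
    show "{h \<in> P. h x = b} \<subseteq> (\<Inter>c\<in>C. V c)"
    proof safe
      fix h c assume h: "h \<in> P" "b = h x" and "c \<in> C"
      then have "h x \<noteq> h c" using C bij[OF h(1)] by (auto dest: bij_is_inj injD)
      with h show "h \<in> V c"
        using transposition_not_commuting_3_cycle[OF assms, of "h c"] by (simp add: V_def)
    qed
    show "(\<Inter>c\<in>C. V c) \<subseteq> {h \<in> P. h x \<in> {b, d, e}}"
    proof
      fix h assume h: "h \<in> (\<Inter>c\<in>C. V c)"
      have "C \<noteq> {}" using C by auto
      then have P: "h \<in> P" using h by (auto simp: V_def)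
      have "h x \<in> {b, d, e}"
      proof (rule ccontr)
        assume "h x \<notin> {b, d, e}"
        then have "h ` C \<subseteq> {b, d, e}"
          using h transposition_commuting_disjoint_3_cycle[of "h x" b d e] unfolding V_def by blast
        then have "card (h ` C) \<le> card {b, d, e}" by (intro card_mono) auto
        moreover have "card (h ` C) = card C"
          using bij[OF P] by (intro card_image) (meson bij_is_inj inj_on_subset subset_UNIV)
        ultimately show False using assms C by simp
      qed
      with P show "h \<in> {h \<in> P. h x \<in> {b, d, e}}" by simp
    qed
  qed
qed

lemma openin_zariski_point_image:
  "openin (zariski_topology (perm_group P)) {h \<in> P. h x = y}"
proof -
  \<comment> \<open>Two 3-cycles through \<open>y\<close> whose supports have no other point in common.\<close>
  have "infinite (UNIV - {y})" using infinite_points by simp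
  then obtain D where "finite D" "card D = 4" "D \<subseteq> UNIV - {y}"
    using infinite_arbitrarily_large by metis
  then obtain ds where ds: "distinct ds" "length ds = 4" "y \<notin> set ds"
    using finite_distinct_list[of D] distinct_card by fastforce
  then obtain d e d' e' where "ds = [d, e, d', e']"
    by (auto simp: length_Suc_conv numeral_eq_Suc)
  with ds have D: "distinct [y, d, e, d', e']" by auto
  obtain U where U: "openin (zariski_topology (perm_group P)) U"
    "{h \<in> P. h x = y} \<subseteq> U" "U \<subseteq> {h \<in> P. h x \<in> {y, d, e}}"
    using openin_zariski_near_point_image[of y d e x] D by auto
  obtain U' where U': "openin (zariski_topology (perm_group P)) U'"
    "{h \<in> P. h x = y} \<subseteq> U'" "U' \<subseteq> {h \<in> P. h x \<in> {y, d', e'}}"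
    using openin_zariski_near_point_image[of y d' e' x] D by auto
  have "U \<inter> U' = {h \<in> P. h x = y}"
  proof
    have "U \<inter> U' \<subseteq> {h \<in> P. h x \<in> {y, d, e}} \<inter> {h \<in> P. h x \<in> {y, d', e'}}"
      using U(3) U'(3) by (rule Int_mono)
    also have "\<dots> \<subseteq> {h \<in> P. h x = y}" using D by auto
    finally show "U \<inter> U' \<subseteq> {h \<in> P. h x = y}" .
    show "{h \<in> P. h x = y} \<subseteq> U \<inter> U'" using U(2) U'(2) by (rule Int_greatest)
  qed
  then show ?thesis using openin_Int[OF U(1) U'(1)] by simp
qed

lemma openin_pointwise_imp_zariski:
  assumes "openin (pointwise_topology P) U"
  shows "openin (zariski_topology (perm_group P)) U"
proof -
  have "generate_topology_on {{f \<in> P. f x = y} |x y. True} U"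
    using assms by (simp add: pointwise_topology_def openin_topology_generated_by_iff)
  then show ?thesis
    by induction (auto intro: openin_Union openin_zariski_point_image)
qed

lemma MZ_perm_group: "MZ (perm_group P)"
proof -
  have "openin (pointwise_topology P) U" if "openin (markov_topology (perm_group P)) U" for U
  proof -
    have "U \<subseteq> P" "closedin (pointwise_topology P) (P - U)"
      using that hausdorff_group_topology_pointwise by (simp_all add: openin_markov_topology)
    then show ?thesis by (simp add: openin_closedin_eq)
  qed
  then show ?thesis
    using openin_zariski_imp_markov[OF group_perm_group] openin_pointwise_imp_zariski
    by (auto simp: MZ_def group_perm_group topology_eq)
qed

end

section \<open>Realising a group as a quotient\<close>

definition almost_equal :: "('x \<Rightarrow> 'y) \<Rightarrow> ('x \<Rightarrow> 'y) \<Rightarrow> bool"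
  where "almost_equal f g \<longleftrightarrow> finite {x. f x \<noteq> g x}"

lemma almost_equal_refl: "almost_equal f f"
  by (simp add: almost_equal_def)

lemma almost_equal_comp:
  assumes "almost_equal f f'" "almost_equal g g'" "inj g'"
  shows "almost_equal (f \<circ> g) (f' \<circ> g')"
proof -
  have "{x. (f \<circ> g) x \<noteq> (f' \<circ> g') x} \<subseteq> {x. g x \<noteq> g' x} \<union> g' -` {x. f x \<noteq> f' x}" by auto
  moreover have "finite (g' -` {x. f x \<noteq> f' x})"
    using assms by (intro finite_vimageI) (auto simp: almost_equal_def)
  ultimately show ?thesis
    using assms unfolding almost_equal_def by (meson finite_UnI finite_subset)
qed

lemma almost_equal_inv:
  assumes "almost_equal f g" "bij f" "bij g"
  shows "almost_equal (inv_into UNIV f) (inv_into UNIV g)"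
proof -
  have "{y. inv_into UNIV f y \<noteq> inv_into UNIV g y} \<subseteq> f ` {x. f x \<noteq> g x}"
  proof
    fix y assume y: "y \<in> {y. inv_into UNIV f y \<noteq> inv_into UNIV g y}"
    have "y = f (inv_into UNIV f y)" using assms(2) by (simp add: bij_is_surj surj_f_inv_f)
    moreover have "f (inv_into UNIV f y) \<noteq> g (inv_into UNIV f y)"
      using y calculation assms(3) by (metis (mono_tags, lifting) bij_inv_eq_iff mem_Collect_eq)
    ultimately show "y \<in> f ` {x. f x \<noteq> g x}" by blast
  qed
  then show ?thesis
    using assms(1) unfolding almost_equal_def by (meson finite_imageI finite_subset)
qed

text \<open>
  Left translation on countably many copies of the carrier. Points whose first component lies
  outside of the carrier are fixed, so that the result is a permutation of the whole type.
\<close>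

definition translation :: "('a, 'm) monoid_scheme \<Rightarrow> 'a \<Rightarrow> 'a \<times> nat \<Rightarrow> 'a \<times> nat"
  where "translation G g = (\<lambda>(a, n). (if a \<in> carrier G then g \<otimes>\<^bsub>G\<^esub> a else a, n))"

definition almost_translations :: "('a, 'm) monoid_scheme \<Rightarrow> ('a \<times> nat \<Rightarrow> 'a \<times> nat) set"
  where "almost_translations G =
    {f. bij f \<and> (\<exists>g\<in>carrier G. almost_equal f (translation G g))}"

definition translation_part :: "('a, 'm) monoid_scheme \<Rightarrow> ('a \<times> nat \<Rightarrow> 'a \<times> nat) \<Rightarrow> 'a"
  where "translation_part G f = (THE g. g \<in> carrier G \<and> almost_equal f (translation G g))"

context group
begin

lemma translation_one: "translation G \<one> = id"
  by (auto simp: translation_def fun_eq_iff)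

lemma translation_mult:
  "g \<in> carrier G \<Longrightarrow> h \<in> carrier G \<Longrightarrow> translation G (g \<otimes> h) = translation G g \<circ> translation G h"
  by (auto simp: translation_def fun_eq_iff m_assoc)

lemma translation_inverse:
  assumes "g \<in> carrier G"
  shows "translation G g \<circ> translation G (inv g) = id" "translation G (inv g) \<circ> translation G g = id"
  using assms translation_mult[of g "inv g"] translation_mult[of "inv g" g]
  by (simp_all add: translation_one)

lemma bij_translation: "g \<in> carrier G \<Longrightarrow> bij (translation G g)"
  using translation_inverse by (rule o_bij[rotated])

lemma inv_into_translation:
  "g \<in> carrier G \<Longrightarrow> inv_into UNIV (translation G g) = translation G (inv g)"
  by (rule inv_unique_comp) (auto simp: translation_inverse)

text \<open>
  The countably many copies matter here: two translations that agree in a single point of the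
  form \<open>(\<one>, n)\<close> are equal.
\<close>

lemma almost_equal_translations_unique:
  assumes "almost_equal f (translation G g)" "almost_equal f (translation G h)"
    and "g \<in> carrier G" "h \<in> carrier G"
  shows "g = h"
proof -
  let ?B = "{z. f z \<noteq> translation G g z} \<union> {z. f z \<noteq> translation G h z}"
  have "infinite (range (\<lambda>n::nat. (\<one>, n)))"
    by (rule range_inj_infinite) (auto intro: injI)
  moreover have "finite ?B" using assms by (simp add: almost_equal_def)
  ultimately have "\<not> range (\<lambda>n::nat. (\<one>, n)) \<subseteq> ?B" using finite_subset by blast
  then obtain n where "(\<one>, n) \<notin> ?B" by blast
  then show ?thesis using assms(3,4) by (auto simp: translation_def)
qed

lemma translation_part_eq:
  assumes "g \<in> carrier G" "almost_equal f (translation G g)"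
  shows "translation_part G f = g"
  unfolding translation_part_def
  using assms almost_equal_translations_unique by (intro the_equality) auto

lemma transposition_group_almost_translations: "transposition_group (almost_translations G)"
proof
  show "bij f" if "f \<in> almost_translations G" for f
    using that by (simp add: almost_translations_def)
  show "id \<in> almost_translations G"
    using almost_equal_refl[of id] translation_one
    by (auto simp: almost_translations_def intro!: bexI[of _ \<one>])
  show "f \<circ> f' \<in> almost_translations G"
    if f: "f \<in> almost_translations G" and f': "f' \<in> almost_translations G" for f f'
  proof -
    obtain g g' where g: "g \<in> carrier G" "almost_equal f (translation G g)"
      "g' \<in> carrier G" "almost_equal f' (translation G g')"
      using f f' by (auto simp: almost_translations_def)
    then have "almost_equal (f \<circ> f') (translation G (g \<otimes> g'))"
      using bij_translation[of g'] by (simp add: translation_mult almost_equal_comp bij_is_inj)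
    then show ?thesis using f f' g by (auto simp: almost_translations_def intro: bij_comp)
  qed
  show "inv_into UNIV f \<in> almost_translations G" if "f \<in> almost_translations G" for f
    using that almost_equal_inv[of f] bij_translation inv_into_translation
    by (fastforce simp: almost_translations_def bij_imp_bij_inv)
  show "transposition p q \<in> almost_translations G" for p q
  proof -
    have "{z. transposition p q z \<noteq> id z} \<subseteq> {p, q}" by (auto simp: Transposition.transpose_def)
    then have "almost_equal (transposition p q) id"
      unfolding almost_equal_def by (rule finite_subset) simp
    then show ?thesis
      using translation_one by (auto simp: almost_translations_def intro!: bexI[of _ \<one>])
  qed
  show "infinite (UNIV :: ('a \<times> nat) set)"
    by (simp add: finite_prod)
qed

lemma translation_part_hom:
  "translation_part G \<in> hom (perm_group (almost_translations G)) G"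
proof (rule homI)
  fix f f' assume "f \<in> carrier (perm_group (almost_translations G))"
    "f' \<in> carrier (perm_group (almost_translations G))"
  then obtain g g' where g: "g \<in> carrier G" "almost_equal f (translation G g)"
      "g' \<in> carrier G" "almost_equal f' (translation G g')"
    by (auto simp: almost_translations_def)
  then have "almost_equal (f \<circ> f') (translation G (g \<otimes> g'))"
    using bij_translation[of g'] by (simp add: translation_mult almost_equal_comp bij_is_inj)
  then show "translation_part G (f \<otimes>\<^bsub>perm_group (almost_translations G)\<^esub> f')
      = translation_part G f \<otimes> translation_part G f'"
    using g by (simp add: translation_part_eq)
qed (auto simp: almost_translations_def translation_part_eq)

lemma translation_part_surj:
  "translation_part G ` carrier (perm_group (almost_translations G)) = carrier G"
proof (intro equalityI subsetI)
  fix g assume g: "g \<in> carrier G"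
  then have "translation G g \<in> almost_translations G"
    using bij_translation almost_equal_refl by (auto simp: almost_translations_def)
  moreover have "translation_part G (translation G g) = g"
    using g by (simp add: translation_part_eq almost_equal_refl)
  ultimately show "g \<in> translation_part G ` carrier (perm_group (almost_translations G))"
    by (metis imageI perm_group_simps(1))
qed (use hom_in_carrier[OF translation_part_hom] in auto)

end

theorem corollary2p1:
  fixes G :: "('a, 'm) monoid_scheme"
  assumes "group G"
  shows "\<exists>(H :: ('a \<times> nat \<Rightarrow> 'a \<times> nat) monoid) N. MZ H \<and> N \<lhd> H \<and> H Mod N \<cong> G"
proof -
  interpret G: group G by fact
  let ?H = "perm_group (almost_translations G)"
  interpret A: transposition_group "almost_translations G"
    by (rule G.transposition_group_almost_translations)
  interpret p: group_hom ?H G "translation_part G"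
    using A.group_perm_group G.translation_part_hom
    by (simp add: group_hom_def group_hom_axioms_def G.is_group)
  have "?H Mod kernel ?H G (translation_part G) \<cong> G"
    by (rule p.FactGroup_iso[OF G.translation_part_surj])
  then show ?thesis using A.MZ_perm_group p.normal_kernel by blast
qed

end
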